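(* Let $n,m\ge1$ and $d\ge0$ be integers. For each multi-index $i\in\mathbb N^m$ with $0\le|i|=i_1+\dots+i_m\le d$ let $f_i:(\mathbb C^n,0)\to(\mathbb C^n,0)$ be a germ of holomorphic map with $f_i(z)=O(z^2)$. Let $A\in GL_n(\mathbb C)$ (its eigenvalues are allowed to be resonant), and for $t\in\mathbb C^m$ let $$f_t(z)=Az+\sum_{i\in\mathbb N^m,\ 0\le|i|\le d}t^if_i(z).$$ Suppose given a family $(h_t)_{t\in\mathbb C^m}$ of formal linearizations, i.e. formal maps with $h_t(0)=0$, $D_0h_t=I$ and $h_t\circ f_t=A\circ h_t$, whose coefficients depend polynomially on $t$, and suppose that there are constants $C_0,C_1>0$ such that for every $l$ the coefficients of the monomials in $z$ of valuation (total degree) $l$ in $h_t(z)$ are polynomials in $t$ of degree at most $C_0+C_1l$. Then one of the following two alternatives holds: 1) For all $t\in\mathbb C^m$ the series $h_t$ converges near $0$, i.e. the family $(f_t)_{t\in\mathbb C^m}$ is holomorphically linearized by the family $(h_t)_{t\in\mathbb C^m}$. 2) There is a set $E\subset\mathbb C^m$ of $\Gamma$-capacity $0$ such that $h_t$ diverges for every $t\in\mathbb C^m\setminus E$.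
   Context: Resonant means that the eigenvalues $\lambda_1,\dots,\lambda_n$ of $A$ satisfy some relation $\lambda_j=\lambda_1^{k_1}\cdots\lambda_n^{k_n}$ with $k\in\mathbb N^n$, $k_1+\dots+k_n\ge2$. A formal power series in $z$ "diverges" if it converges in no neighbourhood of $0$. $\Gamma$-capacity: for $E\subset\mathbb C$, $\mathrm{Cap}(E)$ is the logarithmic capacity, $\mathrm{Cap}(E)=\sup_\mu e^{I(\mu)}$, with $I(\mu)=\iint\log|z-w|\,d\mu(z)d\mu(w)$ and $\mu$ ranging over Borel probability measures with compact support in $E$ (with $\mathrm{Cap}(\emptyset)=0$). For $E\subset\mathbb C^m$, $m\ge2$, let $\Gamma_m^{m-1}(E)$ be the set of $z\in\mathbb C^{m-1}$ such that $\{w\in\mathbb C:(z,w)\in E\}$ has positive capacity, and let $\Gamma_m^1(E)=\Gamma_2^1\circ\Gamma_3^2\circ\cdots\circ\Gamma_m^{m-1}(E)\subset\mathbb C$ (with $\Gamma_1^1(E)=E$ when $m=1$). Then $\Gamma\text{-Cap}(E)=\sup_{U\in U(m,\mathbb C)}\mathrm{Cap}\,\Gamma_m^1(U(E))$, $U$ ranging over unitary transformations of $\mathbb C^m$. *)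

theory Defs
  imports "HOL-Analysis.Analysis" "HOL-Probability.Probability" "HOL-Library.Landau_Symbols"
begin

section \<open>Formal power series in several variables\<close>

text \<open>
  Formal power series over the complex numbers in the variables \<open>z $ x\<close>, \<open>x :: 'n\<close>, given by
  their coefficients; a multi-index is a function \<open>'n \<Rightarrow> nat\<close>.
\<close>

typedef 'n mfps = "UNIV :: (('n \<Rightarrow> nat) \<Rightarrow> complex) set"
  morphisms mcoeff Abs_mfps
  by simp

lemma mcoeff_Abs_mfps [simp]: "mcoeff (Abs_mfps c) = c"
  by (simp add: Abs_mfps_inverse)

lemma mfps_eqI: "(\<And>k. mcoeff a k = mcoeff b k) \<Longrightarrow> a = b"
  by (simp add: mcoeff_inject[symmetric] fun_eq_iff)

lemma finite_mindex_le [simp]: "finite {p. p \<le> (k :: 'n::finite \<Rightarrow> nat)}"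
proof -
  have "{p. p \<le> k} \<subseteq> (\<Pi>\<^sub>E x\<in>UNIV. {..k x})"
    by (auto simp: le_fun_def)
  thus ?thesis
    by (rule finite_subset) (auto intro: finite_PiE)
qed

instantiation mfps :: (finite) comm_ring_1
begin

definition zero_mfps :: "'a mfps"
  where "0 = Abs_mfps (\<lambda>_. 0)"

definition one_mfps :: "'a mfps"
  where "1 = Abs_mfps (\<lambda>k. if k = (\<lambda>_. 0) then 1 else 0)"

definition plus_mfps :: "'a mfps \<Rightarrow> 'a mfps \<Rightarrow> 'a mfps"
  where "a + b = Abs_mfps (\<lambda>k. mcoeff a k + mcoeff b k)"

definition uminus_mfps :: "'a mfps \<Rightarrow> 'a mfps"
  where "- a = Abs_mfps (\<lambda>k. - mcoeff a k)"

definition minus_mfps :: "'a mfps \<Rightarrow> 'a mfps \<Rightarrow> 'a mfps"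
  where "a - b = Abs_mfps (\<lambda>k. mcoeff a k - mcoeff b k)"

definition times_mfps :: "'a mfps \<Rightarrow> 'a mfps \<Rightarrow> 'a mfps"
  where "a * b = Abs_mfps (\<lambda>k. \<Sum>p | p \<le> k. mcoeff a p * mcoeff b (\<lambda>x. k x - p x))"

instance
proof
  fix a b c :: "'a mfps"
  show "a * b * c = a * (b * c)"
  proof (rule mfps_eqI)
    fix k :: "'a \<Rightarrow> nat"
    let ?A = "SIGMA p:{p. p \<le> k}. {q. q \<le> p}"
    let ?B = "SIGMA q:{q. q \<le> k}. {r. r \<le> (\<lambda>x. k x - q x)}"
    have "mcoeff (a * b * c) k =
        (\<Sum>(p, q)\<in>?A. mcoeff a q * mcoeff b (\<lambda>x. p x - q x) * mcoeff c (\<lambda>x. k x - p x))"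
      by (simp add: times_mfps_def sum_distrib_right sum.Sigma)
    also have "\<dots> = (\<Sum>(q, r)\<in>?B. mcoeff a q * (mcoeff b r * mcoeff c (\<lambda>x. k x - q x - r x)))"
    proof (rule sum.reindex_bij_witness[of _ "\<lambda>(q, r). (\<lambda>x. q x + r x, q)"
          "\<lambda>(p, q). (q, \<lambda>x. p x - q x)"], goal_cases)
      case (1 u)
      then show ?case by (auto simp: le_fun_def)
    next
      case (2 u)
      then show ?case
        by (clarsimp simp: le_fun_def) (meson diff_le_mono order_trans)
    next
      case (3 u)
      then show ?case by auto
    next
      case (4 u)
      then show ?case
        by (clarsimp simp: le_fun_def) (metis Nat.le_diff_conv2 add.commute order_trans le_add1)
    next
      case (5 u)
      then obtain p q where u: "u = (p, q)" "p \<le> k" "q \<le> p" by auto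
      have "(\<lambda>x. k x - q x - (p x - q x)) = (\<lambda>x. k x - p x)"
        using u by (auto simp: le_fun_def fun_eq_iff)
      then show ?case using u by (simp add: mult.assoc)
    qed
    also have "\<dots> = mcoeff (a * (b * c)) k"
      by (simp add: times_mfps_def sum_distrib_left sum.Sigma)
    finally show "mcoeff (a * b * c) k = mcoeff (a * (b * c)) k" .
  qed
  show "a * b = b * a"
  proof (rule mfps_eqI)
    fix k :: "'a \<Rightarrow> nat"
    have *: "(\<lambda>x. k x - (k x - p x)) = p" if "p \<le> k" for p
      using that by (auto simp: le_fun_def fun_eq_iff)
    show "mcoeff (a * b) k = mcoeff (b * a) k"
      unfolding times_mfps_def mcoeff_Abs_mfps
      by (rule sum.reindex_bij_witness[of _ "\<lambda>p x. k x - p x" "\<lambda>p x. k x - p x"])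
        (auto simp: * mult.commute le_fun_def)
  qed
  show "1 * a = a"
  proof (rule mfps_eqI)
    fix k :: "'a \<Rightarrow> nat"
    have "mcoeff (1 * a) k =
        (\<Sum>p | p \<le> k. if p = (\<lambda>_. 0) then mcoeff a (\<lambda>x. k x - p x) else 0)"
      unfolding times_mfps_def one_mfps_def mcoeff_Abs_mfps by (rule sum.cong) auto
    also have "\<dots> = mcoeff a k"
      by (subst sum.delta[OF finite_mindex_le]) (auto simp: le_fun_def)
    finally show "mcoeff (1 * a) k = mcoeff a k" .
  qed
  show "(a + b) * c = a * c + b * c"
    by (rule mfps_eqI) (simp add: times_mfps_def plus_mfps_def algebra_simps sum.distrib)
  show "(0 :: 'a mfps) \<noteq> 1"
    by (auto simp: zero_mfps_def one_mfps_def Abs_mfps_inject fun_eq_iff)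
qed (rule mfps_eqI; simp add: plus_mfps_def zero_mfps_def uminus_mfps_def minus_mfps_def)+

end

definition mdeg :: "('n::finite \<Rightarrow> nat) \<Rightarrow> nat"
  where "mdeg k = (\<Sum>x\<in>UNIV. k x)"

definition munit :: "'n \<Rightarrow> 'n \<Rightarrow> nat"
  where "munit x = (\<lambda>y. if y = x then 1 else 0)"

definition zmonom :: "complex^'n \<Rightarrow> ('n::finite \<Rightarrow> nat) \<Rightarrow> complex"
  where "zmonom z k = (\<Prod>x\<in>UNIV. (z $ x) ^ k x)"

definition mfps_const :: "complex \<Rightarrow> 'n mfps"
  where "mfps_const c = Abs_mfps (\<lambda>k. if k = (\<lambda>_. 0) then c else 0)"

text \<open>
  Substitution \<open>a(F\<^sub>1, \<dots>, F\<^sub>n)\<close>, meaningful when every \<open>F $ x\<close> has zero constant term: then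
  \<open>\<Prod>x. (F $ x) ^ j x\<close> has no terms of total degree less than \<open>mdeg j\<close>, so that the finite sum
  below omits only vanishing terms.
\<close>

definition mfps_compose :: "'n::finite mfps \<Rightarrow> 'n mfps ^ 'n \<Rightarrow> 'n mfps"
  where "mfps_compose a F =
    Abs_mfps (\<lambda>k. \<Sum>j | mdeg j \<le> mdeg k. mcoeff a j * mcoeff (\<Prod>x\<in>UNIV. (F $ x) ^ j x) k)"

text \<open>For series in several variables, convergence at a point means unconditional convergence.\<close>

definition mfps_converges :: "'n::finite mfps ^ 'n \<Rightarrow> bool"
  where "mfps_converges h \<longleftrightarrow>
    (\<exists>V. open V \<and> 0 \<in> V \<and>
      (\<forall>z\<in>V. \<forall>x. (\<lambda>k. mcoeff (h $ x) k * zmonom z k) summable_on UNIV))"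

definition has_mfps_expansion ::
    "(complex^'n \<Rightarrow> complex^'n) \<Rightarrow> 'n::finite mfps ^ 'n \<Rightarrow> bool"
  where "has_mfps_expansion f F \<longleftrightarrow>
    (\<exists>V. open V \<and> 0 \<in> V \<and>
      (\<forall>z\<in>V. \<forall>x. ((\<lambda>k. mcoeff (F $ x) k * zmonom z k) has_sum f z $ x) UNIV))"

section \<open>Holomorphic germs and formal linearizations\<close>

text \<open>Germs \<open>(\<complex>\<^sup>n, 0) \<rightarrow> (\<complex>\<^sup>n, 0)\<close>; the derivative is required to be complex linear.\<close>

definition holomorphic_germ :: "(complex^'n \<Rightarrow> complex^'n::finite) \<Rightarrow> bool"
  where "holomorphic_germ f \<longleftrightarrow> f 0 = 0 \<and>
    (\<exists>V. open V \<and> 0 \<in> V \<and>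
      (\<forall>z\<in>V. \<exists>D :: complex^'n^'n. (f has_derivative (\<lambda>v. D *v v)) (at z)))"

definition formal_linearization ::
    "complex^'n^'n \<Rightarrow> (complex^'n \<Rightarrow> complex^'n) \<Rightarrow> 'n::finite mfps ^ 'n \<Rightarrow> bool"
  where "formal_linearization A f h \<longleftrightarrow>
    (\<forall>x. mcoeff (h $ x) (\<lambda>_. 0) = 0) \<and>
    (\<forall>x y. mcoeff (h $ x) (munit y) = (if x = y then 1 else 0)) \<and>
    (\<exists>F. has_mfps_expansion f F \<and>
      (\<forall>x. mfps_compose (h $ x) F = (\<Sum>y\<in>UNIV. mfps_const (A $ x $ y) * h $ y)))"

section \<open>The parameter space\<close>

text \<open>
  The \<open>\<Gamma>\<close>-capacity is defined by recursion on the dimension \<open>m\<close> of the parameter space, hence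
  \<open>\<complex>\<^sup>m\<close> is the set of functions on \<open>{..<m}\<close> rather than a type.
\<close>

definition cspace :: "nat \<Rightarrow> (nat \<Rightarrow> complex) set"
  where "cspace m = {..<m} \<rightarrow>\<^sub>E UNIV"

definition mindex :: "nat \<Rightarrow> (nat \<Rightarrow> nat) set"
  where "mindex m = {..<m} \<rightarrow>\<^sub>E UNIV"

definition tmonom :: "nat \<Rightarrow> (nat \<Rightarrow> complex) \<Rightarrow> (nat \<Rightarrow> nat) \<Rightarrow> complex"
  where "tmonom m t i = (\<Prod>j<m. t j ^ i j)"

definition poly_of_degree_le :: "nat \<Rightarrow> real \<Rightarrow> ((nat \<Rightarrow> complex) \<Rightarrow> complex) \<Rightarrow> bool"
  where "poly_of_degree_le m D p \<longleftrightarrow>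
    (\<exists>c :: (nat \<Rightarrow> nat) \<Rightarrow> complex. \<forall>t\<in>cspace m.
      p t = (\<Sum>i | i \<in> mindex m \<and> real (\<Sum>j<m. i j) \<le> D. c i * tmonom m t i))"

definition param_family ::
    "nat \<Rightarrow> nat \<Rightarrow> complex^'n^'n \<Rightarrow> ((nat \<Rightarrow> nat) \<Rightarrow> complex^'n \<Rightarrow> complex^'n) \<Rightarrow>
     (nat \<Rightarrow> complex) \<Rightarrow> complex^'n \<Rightarrow> complex^'n::finite"
  where "param_family m d A f t z =
    A *v z + (\<Sum>i | i \<in> mindex m \<and> (\<Sum>j<m. i j) \<le> d. tmonom m t i *s f i z)"

section \<open>Logarithmic capacity and \<open>\<Gamma>\<close>-capacity\<close>

definition measure_support :: "complex measure \<Rightarrow> complex set"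
  where "measure_support \<mu> = {z. \<forall>V. open V \<and> z \<in> V \<longrightarrow> emeasure \<mu> V > 0}"

definition log_kernel :: "complex \<Rightarrow> complex \<Rightarrow> ereal"
  where "log_kernel z w = (if z = w then -\<infinity> else ereal (ln (norm (z - w))))"

text \<open>
  The energy is the integral of the positive part minus that of the negative part (note that
  \<open>e2ennreal\<close> maps negative numbers to \<open>0\<close>). For compactly supported \<open>\<mu>\<close> the former is finite, so
  the energy is a real number or \<open>-\<infinity>\<close>. The Bochner integral would not do, since it
  is \<open>0\<close> when the energy is \<open>-\<infinity>\<close>.
\<close>

definition log_energy :: "complex measure \<Rightarrow> ereal"
  where "log_energy \<mu> =
    enn2ereal (\<integral>\<^sup>+ z. (\<integral>\<^sup>+ w. e2ennreal (log_kernel z w) \<partial>\<mu>) \<partial>\<mu>) -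
    enn2ereal (\<integral>\<^sup>+ z. (\<integral>\<^sup>+ w. e2ennreal (- log_kernel z w) \<partial>\<mu>) \<partial>\<mu>)"

definition exp_ereal :: "ereal \<Rightarrow> ennreal"
  where "exp_ereal x =
    (if x = -\<infinity> then 0 else if x = \<infinity> then \<infinity> else ennreal (exp (real_of_ereal x)))"

definition log_cap :: "complex set \<Rightarrow> ennreal"
  where "log_cap E =
    (SUP \<mu> \<in> {\<mu>. sets \<mu> = sets borel \<and> prob_space \<mu> \<and>
                compact (measure_support \<mu>) \<and> measure_support \<mu> \<subseteq> E}. exp_ereal (log_energy \<mu>))"

text \<open>
  \<open>gamma_proj m\<close> is \<open>\<Gamma>\<close> from \<open>\<complex>\<^sup>m\<^sup>+\<^sup>1\<close> to \<open>\<complex>\<^sup>m\<close>; the point \<open>(z, w)\<close> is \<open>z(m := w)\<close>.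
  \<open>gamma_one m E\<close> is \<open>\<Gamma>\<^sub>m\<^sup>1(E)\<close> for \<open>m \<ge> 1\<close>, where \<open>\<complex>\<^sup>1\<close> is identified with \<open>\<complex>\<close>
  in the last step; the value for \<open>m = 0\<close> is irrelevant.
\<close>

definition gamma_proj :: "nat \<Rightarrow> (nat \<Rightarrow> complex) set \<Rightarrow> (nat \<Rightarrow> complex) set"
  where "gamma_proj m E = {z \<in> cspace m. log_cap {w. z(m := w) \<in> E} > 0}"

fun gamma_one :: "nat \<Rightarrow> (nat \<Rightarrow> complex) set \<Rightarrow> complex set"
  where
    "gamma_one 0 E = {}"
  | "gamma_one (Suc 0) E = (\<lambda>z. z 0) ` E"
  | "gamma_one (Suc (Suc m)) E = gamma_one (Suc m) (gamma_proj (Suc m) E)"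

definition unitary :: "nat \<Rightarrow> (nat \<Rightarrow> nat \<Rightarrow> complex) \<Rightarrow> bool"
  where "unitary m U \<longleftrightarrow>
    (\<forall>i<m. \<forall>j<m. (\<Sum>k<m. cnj (U k i) * U k j) = (if i = j then 1 else 0))"

definition apply_mat :: "nat \<Rightarrow> (nat \<Rightarrow> nat \<Rightarrow> complex) \<Rightarrow> (nat \<Rightarrow> complex) \<Rightarrow> (nat \<Rightarrow> complex)"
  where "apply_mat m U t = (\<lambda>i\<in>{..<m}. \<Sum>j<m. U i j * t j)"

definition gamma_cap :: "nat \<Rightarrow> (nat \<Rightarrow> complex) set \<Rightarrow> ennreal"
  where "gamma_cap m E = (SUP U \<in> {U. unitary m U}. log_cap (gamma_one m (apply_mat m U ` E)))"

end

theory Submission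
  imports Defs "HOL-Computational_Algebra.Fundamental_Theorem_Algebra"
begin

text \<open>
  Convergence of \<open>h\<^sub>t\<close> means that its coefficients, which are polynomials in \<open>t\<close> of degree
  \<open>O(l)\<close> at valuation \<open>l\<close>, grow at most geometrically. In one variable, suppose that this holds
  on a set of positive capacity. A measure of finite energy then charges a set \<open>F\<close> on which the
  coefficients satisfy one common geometric bound and the potential is bounded; the potential of
  the restriction to \<open>F\<close> is then bounded on the whole plane. For a polynomial \<open>p\<close> with roots
  \<open>a\<^sub>i\<close>, integrating
  \<open>log \<bar>p(z)\<bar> \<le> log \<bar>p(w)\<bar> + \<Sum>\<^sub>i (log\<^sup>- \<bar>w - a\<^sub>i\<bar> + const)\<close> over \<open>w \<in> F\<close> gives the
  Bernstein--Walsh inequality, which carries the geometric bound to every point \<open>z\<close>.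

  In several variables one fills in the last coordinate first: each \<open>z\<close> in the projection
  \<open>\<Gamma>(E)\<close> has its whole fibre in \<open>E\<close>, so that all slices of \<open>E\<close> contain \<open>\<Gamma>(E)\<close> and
  induction applies to them. The only property of polynomials needed is that their restrictions
  to affine lines are polynomials of bounded degree, a property invariant under unitary maps.
\<close>

section \<open>Truncated logarithm and potentials\<close>

text \<open>As \<open>ennreal\<close> sends negative reals to 0, this is max(0, -ln r), with the
  value infinity at r = 0 imposed by hand.\<close>

definition neg_log :: "real \<Rightarrow> ennreal"
  where "neg_log r = (if r = 0 then \<infinity> else ennreal (- ln r))"

lemma e2ennreal_log_kernel: "e2ennreal (- log_kernel z w) = neg_log (dist z w)"
  by (auto simp: log_kernel_def neg_log_def dist_norm)

lemma neg_log_antimono: "0 \<le> r \<Longrightarrow> r \<le> s \<Longrightarrow> neg_log s \<le> neg_log r"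
  by (auto simp: neg_log_def intro!: ennreal_leI)

lemma borel_measurable_neg_log [measurable]: "neg_log \<in> borel_measurable borel"
  unfolding neg_log_def by measurable

text \<open>The factor 2 arises when distances from a point are compared with those from a nearest
  point of a set; it costs only an additive constant.\<close>

lemma neg_log_le_double:
  assumes "r \<ge> 0"
  shows "neg_log r \<le> neg_log (2 * r) + ennreal (ln 2)"
proof (cases "r = 0")
  case False
  then have "- ln r = - ln (2 * r) + ln 2" using assms by (simp add: ln_mult)
  then have "ennreal (- ln r) \<le> ennreal (max 0 (- ln (2 * r)) + ln 2)"
    by (intro ennreal_leI) linarith
  also have "\<dots> = ennreal (- ln (2 * r)) + ennreal (ln 2)"
    by (subst ennreal_plus) (simp_all add: ennreal_max_0)
  finally show ?thesis using False by (simp add: neg_log_def)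
qed (simp add: neg_log_def)

lemma tendsto_neg_log:
  assumes "r \<ge> 0"
  shows "(\<lambda>n. neg_log (r + inverse (real (Suc n)))) \<longlonglongrightarrow> neg_log r"
proof (cases "r = 0")
  case True
  have "filterlim (\<lambda>n. - ln (inverse (real (Suc n)))) at_top sequentially"
    using filterlim_compose[OF ln_at_top filterlim_compose[OF filterlim_real_sequentially filterlim_Suc]]
    by (simp add: ln_inverse)
  then have "(\<lambda>n. ennreal (- ln (inverse (real (Suc n))))) \<longlonglongrightarrow> \<infinity>"
    by (simp add: ennreal_tendsto_top_eq_at_top)
  then show ?thesis using True by (simp add: neg_log_def)
next
  case False
  have "(\<lambda>n. ennreal (- ln (r + inverse (real (Suc n))))) \<longlonglongrightarrow> ennreal (- ln (r + 0))"
    using False assms by (intro tendsto_intros LIMSEQ_inverse_real_of_nat) auto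
  moreover have "r + inverse (real (Suc n)) \<noteq> 0" for n
    using assms by (smt (verit) inverse_positive_iff_positive of_nat_0_less_iff zero_less_Suc)
  ultimately show ?thesis using False by (simp add: neg_log_def)
qed

text \<open>A weak maximum principle. If b is a point of \<open>F\<close> nearest to a, then |b - w|
  \<le> |a - b| + |a - w| \<le> 2 |a - w| for w in \<open>F\<close>, so passing from b to a costs at
  most ln 2 per unit of mass.\<close>

lemma potential_bound_everywhere:
  fixes M :: "complex measure"
  assumes [measurable_cong]: "sets M = sets borel" and [measurable]: "F \<in> sets M" and "F \<noteq> {}"
    and bound: "\<And>b. b \<in> F \<Longrightarrow> (\<integral>\<^sup>+w\<in>F. neg_log (dist b w) \<partial>M) \<le> B"
  shows "(\<integral>\<^sup>+w\<in>F. neg_log (dist a w) \<partial>M) \<le> B + ennreal (ln 2) * emeasure M F"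
proof -
  let ?e = "\<lambda>n. inverse (real (Suc n))"
  let ?g = "\<lambda>n w. neg_log (2 * dist a w + ?e n) * indicator F w"
  \<comment> \<open>\<open>F\<close> need not be closed, so a point of \<open>F\<close> nearest to \<open>a\<close> exists only up to an error \<open>?e n\<close>.\<close>
  have g_le: "(\<integral>\<^sup>+w. ?g n w \<partial>M) \<le> B" for n
  proof -
    have "infdist a F < infdist a F + ?e n" by simp
    then obtain b where b: "b \<in> F" "dist a b < infdist a F + ?e n"
      using cInf_lessD[of "dist a ` F" "infdist a F + ?e n"] \<open>F \<noteq> {}\<close>
      by (auto simp: infdist_notempty)
    have "?g n w \<le> neg_log (dist b w) * indicator F w" for w
    proof (cases "w \<in> F")
      case True
      then have "infdist a F \<le> dist a w" by (rule infdist_le)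
      then have "dist b w \<le> 2 * dist a w + ?e n"
        using b(2) dist_triangle[of b w a] by (simp add: dist_commute)
      then show ?thesis by (intro mult_right_mono neg_log_antimono) auto
    qed auto
    then have "(\<integral>\<^sup>+w. ?g n w \<partial>M) \<le> (\<integral>\<^sup>+w\<in>F. neg_log (dist b w) \<partial>M)"
      by (intro nn_integral_mono)
    with bound[OF b(1)] show ?thesis by (rule order_trans[rotated])
  qed
  \<comment> \<open>Fatou's lemma removes the error: \<open>?g n\<close> converges pointwise and all
    its integrals are at most \<open>B\<close>.\<close>
  have "(\<integral>\<^sup>+w\<in>F. neg_log (2 * dist a w) \<partial>M) = (\<integral>\<^sup>+w. liminf (\<lambda>n. ?g n w) \<partial>M)"
  proof (intro nn_integral_cong)
    fix w
    show "neg_log (2 * dist a w) * indicator F w = liminf (\<lambda>n. ?g n w)"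
      using lim_imp_Liminf[OF _ tendsto_neg_log[of "2 * dist a w"]]
      by (cases "w \<in> F") (simp_all add: Liminf_const)
  qed
  also have "\<dots> \<le> liminf (\<lambda>n. \<integral>\<^sup>+w. ?g n w \<partial>M)"
    by (rule nn_integral_liminf) measurable
  also have "\<dots> \<le> B"
    using Liminf_mono[of "\<lambda>n. \<integral>\<^sup>+w. ?g n w \<partial>M" "\<lambda>n. B" sequentially] g_le
    by (simp add: Liminf_const)
  finally have *: "(\<integral>\<^sup>+w\<in>F. neg_log (2 * dist a w) \<partial>M) \<le> B" .
  have "(\<integral>\<^sup>+w\<in>F. neg_log (dist a w) \<partial>M) \<le>
      (\<integral>\<^sup>+w. neg_log (2 * dist a w) * indicator F w + ennreal (ln 2) * indicator F w \<partial>M)"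
    using neg_log_le_double by (intro nn_integral_mono) (auto split: split_indicator)
  also have "\<dots> = (\<integral>\<^sup>+w\<in>F. neg_log (2 * dist a w) \<partial>M) + ennreal (ln 2) * emeasure M F"
    by (subst nn_integral_add) (auto simp: nn_integral_cmult)
  finally show ?thesis
    using * by (meson add_right_mono order_trans)
qed

section \<open>The Bernstein-Walsh inequality\<close>

text \<open>The product of |w - a| and the exponential is max(1, |w - a|), and |z - a| \<le> |z - w|
  + |w - a| \<le> S max(1, |w - a|).\<close>

lemma dist_le_exp_mult:
  fixes z w a :: complex
  assumes "w \<noteq> a" "dist z w + 1 \<le> S"
  shows "norm (z - a) \<le> S * norm (w - a) * exp (max 0 (- ln (dist a w)))"
proof (cases "norm (w - a) \<ge> 1")
  case True
  have "norm (z - a) \<le> dist z w + norm (w - a)"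
    by (metis dist_norm dist_triangle)
  also have "\<dots> \<le> (dist z w + 1) * norm (w - a)"
    using mult_left_mono[OF True, of "dist z w"] by (simp add: algebra_simps)
  also have "\<dots> \<le> S * norm (w - a)"
    using assms by (intro mult_right_mono) auto
  also have "\<dots> \<le> S * norm (w - a) * exp (max 0 (- ln (dist a w)))"
    using order_trans[OF _ assms(2), of 0] mult_left_mono[of 1 "exp (max 0 (- ln (dist a w)))" "S * norm (w - a)"]
    by simp
  finally show ?thesis .
next
  case False
  then have "exp (max 0 (- ln (dist a w))) = inverse (norm (w - a))"
    using assms by (simp add: max_def dist_norm norm_minus_commute exp_minus)
  moreover have "norm (z - a) \<le> dist z w + norm (w - a)"
    by (metis dist_norm dist_triangle)
  ultimately show ?thesis using False assms by (simp add: mult.assoc)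
qed

text \<open>The function \<open>\<Lambda>\<close> is \<open>\<Sum>\<^sub>i log\<^sup>- \<bar>w - a\<^sub>i\<bar>\<close> with \<open>a\<^sub>i\<close> the roots of the polynomial.\<close>

lemma poly_pointwise_bound:
  fixes p :: "complex poly" and M :: "complex measure"
  assumes sets [measurable_cong]: "sets M = sets borel" and [measurable]: "F \<in> sets M"
    and pot: "\<And>a. (\<integral>\<^sup>+w\<in>F. neg_log (dist a w) \<partial>M) \<le> B"
    and S: "\<And>w. w \<in> F \<Longrightarrow> dist z w + 1 \<le> S"
    and "degree p = n"
  shows "\<exists>\<Lambda> \<in> borel_measurable M. (\<integral>\<^sup>+w\<in>F. \<Lambda> w \<partial>M) \<le> of_nat n * B \<and>
    (\<forall>w\<in>F. \<forall>r. \<Lambda> w \<le> ennreal r \<longrightarrow> 0 \<le> r \<longrightarrow> norm (poly p z) \<le> S ^ n * norm (poly p w) * exp r)"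
  using \<open>degree p = n\<close>
proof (induction n arbitrary: p)
  case 0
  then obtain c where "p = [:c:]" by (meson degree_eq_zeroE)
  then show ?case
    by (intro bexI[of _ "\<lambda>_. 0"]) (auto intro: mult_left_mono[of 1 "exp _", simplified])
next
  case (Suc n)
  then have "\<not> constant (poly p)" by (simp add: constant_degree)
  \<comment> \<open>Each root split off contributes one factor bounded by
    \<open>dist_le_exp_mult\<close> and one summand of \<open>\<Lambda>\<close>.\<close>
  then obtain a where "poly p a = 0" using fundamental_theorem_of_algebra by blast
  then obtain q where p: "p = [:- a, 1:] * q" by (metis dvdE poly_eq_0_iff_dvd)
  have "q \<noteq> 0" using Suc.prems p by auto
  then have "degree q = n" using Suc.prems unfolding p by (subst (asm) degree_mult_eq) auto
  then obtain \<Lambda> where [measurable]: "\<Lambda> \<in> borel_measurable M"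
    and int: "(\<integral>\<^sup>+w\<in>F. \<Lambda> w \<partial>M) \<le> of_nat n * B"
    and q: "\<And>w r. w \<in> F \<Longrightarrow> \<Lambda> w \<le> ennreal r \<Longrightarrow> 0 \<le> r \<Longrightarrow>
      norm (poly q z) \<le> S ^ n * norm (poly q w) * exp r"
    using Suc.IH by blast
  let ?L = "\<lambda>w. neg_log (dist a w) + \<Lambda> w"
  show ?case
  proof (intro bexI[of _ ?L] conjI ballI allI impI)
    have "(\<integral>\<^sup>+w\<in>F. ?L w \<partial>M) = (\<integral>\<^sup>+w\<in>F. neg_log (dist a w) \<partial>M) + (\<integral>\<^sup>+w\<in>F. \<Lambda> w \<partial>M)"
      by (subst nn_integral_add[symmetric]) (auto simp: distrib_right)
    also have "\<dots> \<le> B + of_nat n * B" by (intro add_mono pot int)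
    finally show "(\<integral>\<^sup>+w\<in>F. ?L w \<partial>M) \<le> of_nat (Suc n) * B" by (simp add: distrib_right)
  next
    fix w and r :: real
    assume w: "w \<in> F" and r: "?L w \<le> ennreal r" "0 \<le> r"
    \<comment> \<open>\<open>?L\<close> is infinite at the root, so a real bound r excludes it;
      quantifying over r avoids exponentials of extended reals.\<close>
    have "w \<noteq> a" using r(1) by (auto simp: neg_log_def top_unique)
    define s where "s = max 0 (- ln (dist a w))"
    have "neg_log (dist a w) = ennreal s"
      using \<open>w \<noteq> a\<close> by (auto simp: neg_log_def s_def max_def ennreal_neg)
    moreover obtain u where u: "\<Lambda> w = ennreal u" "0 \<le> u"
      using r(1) by (cases "\<Lambda> w") (auto simp: top_unique)
    moreover have "s \<ge> 0" by (simp add: s_def)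
    ultimately have "s + u \<le> r"
      using r by (simp flip: ennreal_plus)
    have "S \<ge> 1" using S[OF w] zero_le_dist[of z w] by linarith
    have "norm (poly p z) = norm (z - a) * norm (poly q z)"
      unfolding p poly_mult norm_mult by (simp add: norm_minus_commute)
    also have "\<dots> \<le> (S * norm (w - a) * exp s) * (S ^ n * norm (poly q w) * exp u)"
      using dist_le_exp_mult[OF \<open>w \<noteq> a\<close> S[OF w]] q[OF w] u \<open>S \<ge> 1\<close>
      by (intro mult_mono) (auto simp: s_def)
    also have "\<dots> = S ^ Suc n * norm (poly p w) * exp (s + u)"
      unfolding p poly_mult norm_mult exp_add by simp
    also have "\<dots> \<le> S ^ Suc n * norm (poly p w) * exp r"
      using \<open>s + u \<le> r\<close> \<open>S \<ge> 1\<close> by (intro mult_left_mono) auto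
    finally show "norm (poly p z) \<le> S ^ Suc n * norm (poly p w) * exp r" .
  qed measurable
qed

text \<open>Averaging \<open>\<Lambda>\<close> over \<open>F\<close> yields a point w where it is at
  most linear in the degree, and the pointwise bound is applied at that w. \<open>Q\<close> is
  chosen before the polynomial, which makes it usable for a whole family.\<close>

lemma bernstein_walsh:
  fixes M :: "complex measure"
  assumes sets [measurable_cong]: "sets M = sets borel" and F [measurable]: "F \<in> sets M"
    and "emeasure M F > 0" "emeasure M F < \<infinity>" "bounded F" "B < \<infinity>"
    and pot: "\<And>a. (\<integral>\<^sup>+w\<in>F. neg_log (dist a w) \<partial>M) \<le> B"
  obtains Q :: real where "Q \<ge> 1"
    "\<And>p K. (\<And>w. w \<in> F \<Longrightarrow> norm (poly p w) \<le> K) \<Longrightarrow> norm (poly p z) \<le> K * Q ^ Suc (degree p)"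
proof -
  obtain R where R: "\<And>w. w \<in> F \<Longrightarrow> dist z w \<le> R"
    using \<open>bounded F\<close> bounded_any_center by blast
  define S where "S = max 0 R + 1"
  have S: "S \<ge> 1" "\<And>w. w \<in> F \<Longrightarrow> dist z w + 1 \<le> S"
    using R by (fastforce simp: S_def)+
  \<comment> \<open>\<open>c\<close> is any real above \<open>B\<close> divided by the mass of
    \<open>F\<close>.\<close>
  obtain c :: real where c: "c > 0" "B < ennreal c * emeasure M F"
  proof -
    obtain b where b: "B = ennreal b" "b \<ge> 0" using \<open>B < \<infinity>\<close> by (cases B) auto
    obtain e where e: "emeasure M F = ennreal e" "e > 0"
      using assms by (cases "emeasure M F") auto
    have "b < (b + 1) / e * e" using e by simp
    then have "B < ennreal ((b + 1) / e) * emeasure M F"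
      using b e by (simp add: ennreal_mult[symmetric] ennreal_lessI)
    moreover have "(b + 1) / e > 0" using b e by simp
    ultimately show ?thesis using that by blast
  qed
  show thesis
  proof (rule that[of "S * exp c"])
    show "S * exp c \<ge> 1" using S c mult_mono[of 1 S 1 "exp c"] by simp
  next
    fix p K
    assume K: "\<And>w. w \<in> F \<Longrightarrow> norm (poly p w) \<le> K"
    let ?n = "degree p"
    obtain \<Lambda> where \<Lambda>: "\<Lambda> \<in> borel_measurable M" "(\<integral>\<^sup>+w\<in>F. \<Lambda> w \<partial>M) \<le> of_nat ?n * B"
      "\<And>w r. w \<in> F \<Longrightarrow> \<Lambda> w \<le> ennreal r \<Longrightarrow> 0 \<le> r \<Longrightarrow>
        norm (poly p z) \<le> S ^ ?n * norm (poly p w) * exp r"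
      using poly_pointwise_bound[OF sets F pot S(2) refl, of p] by blast
    \<comment> \<open>Otherwise the integral of \<open>\<Lambda>\<close> would reach (n + 1) c times
      the mass of \<open>F\<close>, which exceeds (n + 1) \<open>B\<close>. The successor keeps this
      strict for constant polynomials too.\<close>
    have "\<exists>w\<in>F. \<Lambda> w \<le> ennreal (Suc ?n * c)"
    proof (rule ccontr)
      assume "\<not> ?thesis"
      then have "ennreal (Suc ?n * c) * indicator F w \<le> \<Lambda> w * indicator F w" for w
        by (auto split: split_indicator)
      then have "ennreal (Suc ?n * c) * emeasure M F \<le> (\<integral>\<^sup>+w\<in>F. \<Lambda> w \<partial>M)"
        by (subst nn_integral_cmult_indicator[symmetric]) (auto intro!: nn_integral_mono)
      also have "\<dots> \<le> of_nat ?n * B" by (rule \<Lambda>(2))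
      also have "\<dots> \<le> of_nat (Suc ?n) * B" by (intro mult_right_mono) auto
      also have "\<dots> < of_nat (Suc ?n) * (ennreal c * emeasure M F)"
        using c(2) by (intro ennreal_mult_strict_left_mono)
          (auto simp: ennreal_of_nat_eq_real_of_nat simp del: of_nat_Suc)
      also have "\<dots> = ennreal (Suc ?n * c) * emeasure M F"
        using c(1) by (simp add: ennreal_mult' mult.assoc ennreal_of_nat_eq_real_of_nat del: of_nat_Suc)
      finally show False by simp
    qed
    then obtain w where w: "w \<in> F" "\<Lambda> w \<le> ennreal (Suc ?n * c)" by blast
    have "K \<ge> 0" using K[OF w(1)] norm_ge_zero order_trans by blast
    have "norm (poly p z) \<le> S ^ ?n * norm (poly p w) * exp (Suc ?n * c)"
      using \<Lambda>(3)[OF w] c(1) by simp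
    also have "\<dots> \<le> S ^ Suc ?n * K * exp (Suc ?n * c)"
      using K[OF w(1)] S(1) by (intro mult_right_mono mult_mono power_increasing) auto
    also have "\<dots> = K * (S * exp c) ^ Suc ?n"
      by (simp add: power_mult_distrib exp_of_nat_mult[symmetric] del: power_Suc of_nat_Suc)
    finally show "norm (poly p z) \<le> K * (S * exp c) ^ Suc ?n" .
  qed
qed

section \<open>Measures of finite energy\<close>

text \<open>The complement of the support is the union of all open null sets, and by Lindelof a
  countable subfamily has the same union.\<close>

lemma AE_measure_support:
  assumes "sets \<mu> = sets borel"
  shows "AE z in \<mu>. z \<in> measure_support \<mu>"
proof -
  define \<F> where "\<F> = {V. open V \<and> emeasure \<mu> V = 0}"
  obtain \<F>' where \<F>': "\<F>' \<subseteq> \<F>" "countable \<F>'" "\<Union>\<F>' = \<Union>\<F>"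
    using Lindelof[of \<F>] by (auto simp: \<F>_def)
  have "(\<Union>V\<in>\<F>'. V) \<in> null_sets \<mu>"
    using \<F>'(1) assms by (intro null_sets_UN' \<F>'(2)) (auto simp: \<F>_def null_sets_def)
  moreover have "{z \<in> space \<mu>. z \<notin> measure_support \<mu>} \<subseteq> (\<Union>V\<in>\<F>'. V)"
    using \<F>'(3) by (auto simp: measure_support_def \<F>_def)
  ultimately show ?thesis by (rule AE_I')
qed

text \<open>On a bounded support the kernel is bounded above, so the positive part of the energy is
  finite and only an infinite negative part could give -\<infinity>.\<close>

lemma finite_log_energy:
  assumes "sets \<mu> = sets borel" "prob_space \<mu>" "compact (measure_support \<mu>)"
    and "log_energy \<mu> \<noteq> -\<infinity>"
  shows "(\<integral>\<^sup>+ z. (\<integral>\<^sup>+ w. neg_log (dist z w) \<partial>\<mu>) \<partial>\<mu>) < \<infinity>"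
proof -
  interpret prob_space \<mu> by fact
  obtain R where R: "\<And>z. z \<in> measure_support \<mu> \<Longrightarrow> norm z \<le> R"
    using compact_imp_bounded[OF assms(3)] by (auto simp: bounded_iff)
  let ?c = "ennreal (ln (2 * max 0 R + 1))"
  have ker: "e2ennreal (log_kernel z w) \<le> ?c" if "norm z \<le> R" "norm w \<le> R" for z w
  proof (cases "z = w")
    case False
    have "norm (z - w) \<le> 2 * max 0 R + 1" using that norm_triangle_ineq4[of z w] by simp
    then show ?thesis using False by (simp add: log_kernel_def ennreal_leI)
  qed (simp add: log_kernel_def e2ennreal_neg)
  note supp = AE_measure_support[OF assms(1)]
  have inner: "(\<integral>\<^sup>+ w. e2ennreal (log_kernel z w) \<partial>\<mu>) \<le> (\<integral>\<^sup>+ w. ?c \<partial>\<mu>)"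
    if "z \<in> measure_support \<mu>" for z
    by (rule nn_integral_mono_AE, rule eventually_mono[OF supp]) (intro ker R that)
  have "(\<integral>\<^sup>+ z. (\<integral>\<^sup>+ w. e2ennreal (log_kernel z w) \<partial>\<mu>) \<partial>\<mu>) \<le> (\<integral>\<^sup>+ z. (\<integral>\<^sup>+ w. ?c \<partial>\<mu>) \<partial>\<mu>)"
    by (rule nn_integral_mono_AE, rule eventually_mono[OF supp]) (rule inner)
  also have "\<dots> < \<infinity>" by (simp add: emeasure_space_1)
  finally obtain r where r: "r \<ge> 0"
    "(\<integral>\<^sup>+ z. (\<integral>\<^sup>+ w. e2ennreal (log_kernel z w) \<partial>\<mu>) \<partial>\<mu>) = ennreal r"
    by (cases "\<integral>\<^sup>+ z. (\<integral>\<^sup>+ w. e2ennreal (log_kernel z w) \<partial>\<mu>) \<partial>\<mu>") auto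
  then have "log_energy \<mu> =
      ereal r - enn2ereal (\<integral>\<^sup>+ z. (\<integral>\<^sup>+ w. neg_log (dist z w) \<partial>\<mu>) \<partial>\<mu>)"
    by (simp add: log_energy_def e2ennreal_log_kernel enn2ereal_ennreal)
  with assms(4) show ?thesis
    by (cases "\<integral>\<^sup>+ z. (\<integral>\<^sup>+ w. neg_log (dist z w) \<partial>\<mu>) \<partial>\<mu>") auto
qed

section \<open>Geometric bounds in one variable\<close>

text \<open>The exponent \<open>Suc (wt i)\<close> absorbs a multiplicative constant into
  \<open>N\<close>; taking \<open>N\<close> natural makes the set of bounded parameters a countable
  union.\<close>

definition geo_bounded :: "('i \<Rightarrow> nat) \<Rightarrow> ('i \<Rightarrow> complex) \<Rightarrow> bool"
  where "geo_bounded wt c \<longleftrightarrow> (\<exists>N::nat. \<forall>i. norm (c i) \<le> real N ^ Suc (wt i))"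

lemma geo_boundedI:
  assumes "\<And>i. norm (c i) \<le> K ^ Suc (wt i)" "K \<ge> 0"
  shows "geo_bounded wt c"
  unfolding geo_bounded_def
proof (intro exI[of _ "nat \<lceil>K\<rceil>"] allI)
  fix i
  have "K ^ Suc (wt i) \<le> real (nat \<lceil>K\<rceil>) ^ Suc (wt i)"
    using \<open>K \<ge> 0\<close> by (intro power_mono) (simp_all add: real_nat_ceiling_ge)
  then show "norm (c i) \<le> real (nat \<lceil>K\<rceil>) ^ Suc (wt i)"
    using assms(1) order_trans by blast
qed

text \<open>Positive capacity provides a measure of finite energy, whose potential is finite almost
  everywhere. Since the degrees are linear in the weight, the Bernstein-Walsh factor is itself
  geometric.\<close>

lemma geo_bounded_poly:
  fixes q :: "'i \<Rightarrow> complex poly"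
  assumes deg: "\<And>i. degree (q i) \<le> c * Suc (wt i)"
    and cap: "log_cap {w. geo_bounded wt (\<lambda>i. poly (q i) w)} > 0"
  shows "geo_bounded wt (\<lambda>i. poly (q i) z)"
proof -
  obtain \<mu> where sets [measurable_cong]: "sets \<mu> = sets borel" and "prob_space \<mu>"
    and compact: "compact (measure_support \<mu>)"
    and supp: "measure_support \<mu> \<subseteq> {w. geo_bounded wt (\<lambda>i. poly (q i) w)}"
    and "exp_ereal (log_energy \<mu>) > 0"
    using cap unfolding log_cap_def less_SUP_iff by blast
  interpret prob_space \<mu> by fact
  have "log_energy \<mu> \<noteq> -\<infinity>"
    using \<open>exp_ereal (log_energy \<mu>) > 0\<close> by (auto simp: exp_ereal_def)
  define u where "u = (\<lambda>z. \<integral>\<^sup>+ w. neg_log (dist z w) \<partial>\<mu>)"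
  have u_meas [measurable]: "u \<in> borel_measurable \<mu>"
    unfolding u_def by measurable
  have "(\<integral>\<^sup>+ z. u z \<partial>\<mu>) < \<infinity>"
    unfolding u_def by (rule finite_log_energy) fact+
  then have fin: "AE z in \<mu>. u z \<noteq> \<infinity>"
    by (intro nn_integral_PInf_AE u_meas) simp
  define E where "E = (\<lambda>N::nat. {w. \<forall>i. norm (poly (q i) w) \<le> real N ^ Suc (wt i)})"
  \<comment> \<open>The three conditions are what \<open>bernstein_walsh\<close> consumes: a common
    bound, a bounded potential and a bounded set. Together these sets carry the full mass, so some
    \<open>F N\<close> is not null.\<close>
  define F where "F = (\<lambda>N::nat. E N \<inter> {z \<in> space \<mu>. u z \<le> of_nat N} \<inter> cball 0 N)"
  \<comment> \<open>An intersection of closed sets, hence measurable whatever the index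
    type.\<close>
  have "closed (E N)" for N
    unfolding E_def by (intro closed_Collect_all closed_Collect_le continuous_intros)
  then have F_meas [measurable]: "F N \<in> sets \<mu>" for N
    unfolding F_def by measurable
  have "AE z in \<mu>. z \<in> (\<Union>N. F N)"
    using fin AE_measure_support[OF sets] AE_space
  proof eventually_elim
    case (elim z)
    obtain N1 where N1: "\<And>i. norm (poly (q i) z) \<le> real N1 ^ Suc (wt i)"
      using elim supp unfolding geo_bounded_def by blast
    obtain N2 where N2: "u z < of_nat N2"
      using elim(1) ennreal_Ex_less_of_nat by (auto simp: less_top)
    obtain N3 where N3: "norm z < real N3" using reals_Archimedean2 by blast
    define N where "N = max N1 (max N2 N3)"
    have "norm (poly (q i) z) \<le> real N ^ Suc (wt i)" for i
      by (rule order_trans[OF N1 power_mono]) (auto simp: N_def)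
    moreover have "u z \<le> of_nat N"
      by (rule order_trans[OF less_imp_le[OF N2]]) (simp add: N_def)
    ultimately have "z \<in> F N" using N3 elim by (auto simp: F_def E_def N_def)
    then show ?case by blast
  qed
  then have "emeasure \<mu> (\<Union>N. F N) = 1" by (intro emeasure_eq_1_AE) auto
  then have "(\<Union>N. F N) \<notin> null_sets \<mu>" by auto
  then obtain N where N: "F N \<notin> null_sets \<mu>" by blast
  then have pos: "emeasure \<mu> (F N) > 0" by (auto simp: null_sets_def zero_less_iff_neq_zero)
  have "(\<integral>\<^sup>+w\<in>F N. neg_log (dist b w) \<partial>\<mu>) \<le> of_nat N" if "b \<in> F N" for b
  proof -
    have "(\<integral>\<^sup>+w\<in>F N. neg_log (dist b w) \<partial>\<mu>) \<le> u b"
      unfolding u_def by (intro nn_integral_mono) (auto split: split_indicator)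
    then show ?thesis using that by (auto simp: F_def)
  qed
  then have "(\<integral>\<^sup>+w\<in>F N. neg_log (dist a w) \<partial>\<mu>) \<le> of_nat N + ennreal (ln 2) * emeasure \<mu> (F N)" for a
    using pos by (intro potential_bound_everywhere sets F_meas) auto
  moreover have "emeasure \<mu> (F N) < \<infinity>" by (simp add: less_top[symmetric])
  moreover have "bounded (F N)" unfolding F_def by (meson bounded_cball bounded_subset inf_le2)
  moreover have "of_nat N + ennreal (ln 2) * emeasure \<mu> (F N) < \<infinity>"
    by (simp add: ennreal_mult_less_top less_top[symmetric] ennreal_mult_eq_top_iff)
  ultimately obtain Q :: real where Q: "Q \<ge> 1"
    "\<And>p K. (\<And>w. w \<in> F N \<Longrightarrow> norm (poly p w) \<le> K) \<Longrightarrow> norm (poly p z) \<le> K * Q ^ Suc (degree p)"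
    using bernstein_walsh[OF sets F_meas pos] by blast
  show ?thesis
  proof (rule geo_boundedI)
    fix i
    have "norm (poly (q i) z) \<le> real N ^ Suc (wt i) * Q ^ Suc (degree (q i))"
      by (rule Q(2)) (auto simp: F_def E_def)
    \<comment> \<open>The extra 1 in \<open>Suc (degree (q i))\<close> is absorbed by raising
      \<open>c\<close> to \<open>Suc c\<close>.\<close>
    also have "\<dots> \<le> real N ^ Suc (wt i) * Q ^ (Suc c * Suc (wt i))"
      using Q(1) deg[of i] by (intro mult_left_mono power_increasing) auto
    also have "\<dots> = (real N * Q ^ Suc c) ^ Suc (wt i)"
      by (simp only: power_mult_distrib power_mult)
    finally show "norm (poly (q i) z) \<le> (real N * Q ^ Suc c) ^ Suc (wt i)" .
  qed (use Q(1) in simp)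
qed

section \<open>Slices, lines and Gamma-capacity\<close>

lemma log_cap_mono: "E \<subseteq> E' \<Longrightarrow> log_cap E \<le> log_cap E'"
  unfolding log_cap_def by (intro SUP_subset_mono) auto

lemma gamma_one_mono: "E \<subseteq> E' \<Longrightarrow> gamma_one m E \<subseteq> gamma_one m E'"
proof (induction m E arbitrary: E' rule: gamma_one.induct)
  case (3 m E)
  have "gamma_proj (Suc m) E \<subseteq> gamma_proj (Suc m) E'"
    unfolding gamma_proj_def using 3(2) by (auto intro: less_le_trans log_cap_mono)
  then show ?case using 3(1) by simp
qed auto

text \<open>Freezing a coordinate and substituting a linear map both send lines to lines, so the
  property survives them without any handling of coefficients. The restriction to
  \<open>{..<m}\<close> keeps the line in \<open>cspace m\<close>.\<close>

definition line_degree_le :: "nat \<Rightarrow> nat \<Rightarrow> ((nat \<Rightarrow> complex) \<Rightarrow> complex) \<Rightarrow> bool"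
  where "line_degree_le m n p \<longleftrightarrow>
    (\<forall>a b. \<exists>q. degree q \<le> n \<and> (\<forall>w. p (\<lambda>j\<in>{..<m}. a j + w * b j) = poly q w))"

lemma line_degree_le_mono: "line_degree_le m n p \<Longrightarrow> n \<le> n' \<Longrightarrow> line_degree_le m n' p"
  unfolding line_degree_le_def by (meson order_trans)

text \<open>Allows a line to be given in another form, such as \<open>z(m := w)\<close> with w
  varying.\<close>

lemma line_degree_leD:
  assumes "line_degree_le m n p" "\<And>w. r w = (\<lambda>j\<in>{..<m}. a j + w * b j)"
  shows "\<exists>q. degree q \<le> n \<and> (\<forall>w. p (r w) = poly q w)"
  using assms by (simp add: line_degree_le_def)

text \<open>Over a point of the projection the fibre has positive capacity, so the one-variable
  result fills it completely. The projection then lies in the good set of the slice through t, to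
  which the induction hypothesis applies.\<close>

lemma geo_bounded_gamma_one:
  assumes "\<And>i. line_degree_le (Suc m) (c * Suc (wt i)) (p i)"
    and "log_cap (gamma_one (Suc m) {t \<in> cspace (Suc m). geo_bounded wt (\<lambda>i. p i t)}) > 0"
    and "t \<in> cspace (Suc m)"
  shows "geo_bounded wt (\<lambda>i. p i t)"
  using assms
proof (induction m arbitrary: p t)
  case 0
  have "\<exists>q. degree q \<le> c * Suc (wt i) \<and> (\<forall>w. p i (\<lambda>j\<in>{..<Suc 0}. w) = poly q w)" for i
    by (rule line_degree_leD[OF 0(1), of _ "\<lambda>_. 0" "\<lambda>_. 1"]) (auto simp: fun_eq_iff)
  then obtain q where q: "\<And>i. degree (q i) \<le> c * Suc (wt i)"
    "\<And>i w. p i (\<lambda>j\<in>{..<Suc 0}. w) = poly (q i) w"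
    by metis
  have p: "p i s = poly (q i) (s 0)" if "s \<in> cspace (Suc 0)" for i s
  proof -
    have "(\<lambda>j\<in>{..<Suc 0}. s 0) = s"
      using that by (auto simp: cspace_def PiE_def extensional_def fun_eq_iff)
    then show ?thesis using q(2)[of i "s 0"] by simp
  qed
  have "gamma_one (Suc 0) {t \<in> cspace (Suc 0). geo_bounded wt (\<lambda>i. p i t)}
      \<subseteq> {w. geo_bounded wt (\<lambda>i. poly (q i) w)}"
    by (auto simp: p)
  then have "log_cap {w. geo_bounded wt (\<lambda>i. poly (q i) w)} > 0"
    using 0(2) log_cap_mono less_le_trans by blast
  then show ?case using geo_bounded_poly[OF q(1)] p[OF 0(3)] by simp
next
  case (Suc m)
  let ?n = "Suc m"
  let ?E = "{t \<in> cspace (Suc ?n). geo_bounded wt (\<lambda>i. p i t)}"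
  have sub: "gamma_proj ?n ?E \<subseteq> {z \<in> cspace ?n. geo_bounded wt (\<lambda>i. p i (z(?n := w)))}" for w
  proof (intro subsetI CollectI conjI)
    fix z assume z: "z \<in> gamma_proj ?n ?E"
    then show zc: "z \<in> cspace ?n" by (simp add: gamma_proj_def)
    \<comment> \<open>The fibre over z is the line through \<open>z(?n := 0)\<close> in the
      direction of the last unit vector.\<close>
    have "z(?n := w) = (\<lambda>j\<in>{..<Suc ?n}. (z(?n := 0)) j + w * of_bool (j = ?n))" for w
      using zc by (auto simp: cspace_def PiE_def extensional_def fun_eq_iff)
    then have "\<exists>q. degree q \<le> c * Suc (wt i) \<and> (\<forall>w. p i (z(?n := w)) = poly q w)" for i
      by (rule line_degree_leD[OF Suc.prems(1)])
    then obtain q where q: "\<And>i. degree (q i) \<le> c * Suc (wt i)"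
      and p: "\<And>i w. p i (z(?n := w)) = poly (q i) w"
      by metis
    have "log_cap {w. z(?n := w) \<in> ?E} > 0" using z by (simp add: gamma_proj_def)
    moreover have "{w. z(?n := w) \<in> ?E} \<subseteq> {w. geo_bounded wt (\<lambda>i. poly (q i) w)}"
      by (auto simp: p)
    ultimately have "log_cap {w. geo_bounded wt (\<lambda>i. poly (q i) w)} > 0"
      using log_cap_mono less_le_trans by blast
    then show "geo_bounded wt (\<lambda>i. p i (z(?n := w)))"
      using geo_bounded_poly[OF q(1)] by (simp add: p)
  qed
  let ?w = "t ?n"
  have "geo_bounded wt (\<lambda>i. p i ((restrict t {..<?n})(?n := ?w)))"
  proof (rule Suc.IH[where p = "\<lambda>i z. p i (z(?n := ?w))"])
    fix i
    show "line_degree_le ?n (c * Suc (wt i)) (\<lambda>z. p i (z(?n := ?w)))"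
      unfolding line_degree_le_def
    proof (intro allI)
      fix a b :: "nat \<Rightarrow> complex"
      \<comment> \<open>A line in the slice is a line of the larger space whose direction has last
        coordinate 0.\<close>
      have "(\<lambda>j\<in>{..<?n}. a j + w * b j)(?n := ?w) =
          (\<lambda>j\<in>{..<Suc ?n}. (a(?n := ?w)) j + w * (b(?n := 0)) j)" for w
        by (auto simp: fun_eq_iff)
      then show "\<exists>q. degree q \<le> c * Suc (wt i) \<and>
          (\<forall>w. p i ((\<lambda>j\<in>{..<?n}. a j + w * b j)(?n := ?w)) = poly q w)"
        by (rule line_degree_leD[OF Suc.prems(1)])
    qed
  next
    have "0 < log_cap (gamma_one ?n (gamma_proj ?n ?E))" using Suc.prems(2) by simp
    also have "\<dots> \<le> log_cap (gamma_one ?n {z \<in> cspace ?n. geo_bounded wt (\<lambda>i. p i (z(?n := ?w)))})"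
      by (intro log_cap_mono gamma_one_mono sub)
    finally show "0 < log_cap (gamma_one ?n {z \<in> cspace ?n. geo_bounded wt (\<lambda>i. p i (z(?n := ?w)))})" .
  qed (auto simp: cspace_def split: if_splits)
  moreover have "(restrict t {..<?n})(?n := ?w) = t"
    using Suc.prems(3) by (auto simp: cspace_def PiE_def extensional_def fun_eq_iff)
  ultimately show ?case by simp
qed

lemma line_degree_le_apply_mat:
  assumes "line_degree_le m n p"
  shows "line_degree_le m n (\<lambda>t. p (apply_mat m V t))"
  unfolding line_degree_le_def
proof (intro allI)
  fix a b :: "nat \<Rightarrow> complex"
  have "apply_mat m V (\<lambda>j\<in>{..<m}. a j + w * b j) =
      (\<lambda>i\<in>{..<m}. (\<Sum>j<m. V i j * a j) + w * (\<Sum>j<m. V i j * b j))" for w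
    by (simp add: apply_mat_def fun_eq_iff sum_distrib_left sum.distrib distrib_left mult.left_commute)
  then show "\<exists>q. degree q \<le> n \<and> (\<forall>w. p (apply_mat m V (\<lambda>j\<in>{..<m}. a j + w * b j)) = poly q w)"
    by (rule line_degree_leD[OF assms])
qed

lemma apply_mat_adjoint:
  assumes "unitary m U" "t \<in> cspace m"
  shows "apply_mat m (\<lambda>i j. cnj (U j i)) (apply_mat m U t) = t"
proof
  fix i
  show "apply_mat m (\<lambda>i j. cnj (U j i)) (apply_mat m U t) i = t i"
  proof (cases "i < m")
    case True
    have "apply_mat m (\<lambda>i j. cnj (U j i)) (apply_mat m U t) i =
        (\<Sum>k<m. \<Sum>j<m. cnj (U k i) * U k j * t j)"
      using True by (simp add: apply_mat_def sum_distrib_left mult.assoc)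
    also have "\<dots> = (\<Sum>j<m. (\<Sum>k<m. cnj (U k i) * U k j) * t j)"
      by (subst sum.swap) (simp add: sum_distrib_right)
    also have "\<dots> = (\<Sum>j<m. if i = j then t j else 0)"
      using assms(1) True by (intro sum.cong) (auto simp: unitary_def)
    finally show ?thesis using True by simp
  next
    case False
    then show ?thesis using assms(2) by (auto simp: apply_mat_def cspace_def PiE_def extensional_def)
  qed
qed

text \<open>A unitary \<open>U\<close> with positive capacity is undone by composing the family with
  its adjoint; the transported family is then evaluated at the image of t under
  \<open>U\<close>.\<close>

lemma geo_bounded_gamma_cap:
  assumes "m \<ge> 1" and deg: "\<And>i. line_degree_le m (c * Suc (wt i)) (p i)"
    and cap: "gamma_cap m {t \<in> cspace m. geo_bounded wt (\<lambda>i. p i t)} > 0"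
    and t: "t \<in> cspace m"
  shows "geo_bounded wt (\<lambda>i. p i t)"
proof -
  let ?E = "{t \<in> cspace m. geo_bounded wt (\<lambda>i. p i t)}"
  obtain U where U: "unitary m U" and pos: "log_cap (gamma_one m (apply_mat m U ` ?E)) > 0"
    using cap unfolding gamma_cap_def less_SUP_iff by blast
  let ?V = "\<lambda>i j. cnj (U j i)"
  obtain m' where m: "m = Suc m'" using \<open>m \<ge> 1\<close> by (cases m) auto
  have "apply_mat m U ` ?E \<subseteq> {s \<in> cspace m. geo_bounded wt (\<lambda>i. p i (apply_mat m ?V s))}"
    using apply_mat_adjoint[OF U] by (auto simp: apply_mat_def cspace_def)
  then have "log_cap (gamma_one m {s \<in> cspace m. geo_bounded wt (\<lambda>i. p i (apply_mat m ?V s))}) > 0"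
    using pos log_cap_mono[OF gamma_one_mono] less_le_trans by blast
  then have "geo_bounded wt (\<lambda>i. p i (apply_mat m ?V (apply_mat m U t)))"
    by (intro geo_bounded_gamma_one[of m' c wt "\<lambda>i t. p i (apply_mat m ?V t)", folded m]
        line_degree_le_apply_mat deg) (auto simp: apply_mat_def cspace_def)
  then show ?thesis by (simp add: apply_mat_adjoint[OF U t])
qed

text \<open>Along a line each coordinate becomes a linear polynomial \<open>[:a j, b j:]\<close>, so
  a monomial becomes a product of at most its total degree many linear factors.\<close>

lemma line_degree_le_poly_of_degree_le:
  assumes "poly_of_degree_le m D p"
  shows "line_degree_le m (nat \<lfloor>D\<rfloor>) p"
  unfolding line_degree_le_def
proof (intro allI)
  fix a b :: "nat \<Rightarrow> complex"
  let ?I = "{i. i \<in> mindex m \<and> real (\<Sum>j<m. i j) \<le> D}"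
  obtain c where c: "\<And>t. t \<in> cspace m \<Longrightarrow> p t = (\<Sum>i\<in>?I. c i * tmonom m t i)"
    using assms unfolding poly_of_degree_le_def by blast
  define r where "r i = smult (c i) (\<Prod>j<m. [:a j, b j:] ^ i j)" for i
  have "degree (r i) \<le> nat \<lfloor>D\<rfloor>" if "i \<in> ?I" for i
  proof -
    have "degree (\<Prod>j<m. [:a j, b j:] ^ i j) \<le> (\<Sum>j<m. degree ([:a j, b j:] ^ i j))"
      using degree_prod_sum_le[of "{..<m}" "\<lambda>j. [:a j, b j:] ^ i j"] by simp
    also have "\<dots> \<le> (\<Sum>j<m. i j)"
      by (intro sum_mono order_trans[OF degree_power_le]) (auto simp: degree_pCons_eq_if)
    also have "\<dots> \<le> nat \<lfloor>D\<rfloor>" using that by (auto intro: le_nat_floor)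
    finally show ?thesis unfolding r_def using degree_smult_le order_trans by blast
  qed
  then have "degree (\<Sum>i\<in>?I. r i) \<le> nat \<lfloor>D\<rfloor>"
    \<comment> \<open>A sum over an infinite index set would be 0 by convention, so the bound holds
      in either case.\<close>
    by (cases "finite ?I") (auto intro: degree_sum_le)
  moreover have "p (\<lambda>j\<in>{..<m}. a j + w * b j) = poly (\<Sum>i\<in>?I. r i) w" for w
    by (subst c) (auto simp: cspace_def r_def tmonom_def poly_sum poly_prod intro!: sum.cong)
  ultimately show "\<exists>q. degree q \<le> nat \<lfloor>D\<rfloor> \<and> (\<forall>w. p (\<lambda>j\<in>{..<m}. a j + w * b j) = poly q w)"
    by blast
qed

section \<open>Convergence as geometric growth of coefficients\<close>

lemma norm_zmonom: "norm (zmonom z k) = (\<Prod>x\<in>UNIV. norm (z $ x) ^ k x)"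
  by (simp add: zmonom_def prod_norm[symmetric] norm_power)

text \<open>At a diagonal point (r, ..., r) with r > 0 inside the region of convergence every
  monomial has modulus r to the total degree, and the terms of a summable family are
  bounded.\<close>

lemma geo_bounded_if_mfps_converges:
  fixes h :: "'n::finite mfps ^ 'n"
  assumes "mfps_converges h"
  shows "geo_bounded (\<lambda>(x, k). mdeg k) (\<lambda>(x, k). mcoeff (h $ x) k)"
proof -
  obtain V where V: "open V" "0 \<in> V"
    "\<And>z x. z \<in> V \<Longrightarrow> (\<lambda>k. mcoeff (h $ x) k * zmonom z k) summable_on UNIV"
    using assms unfolding mfps_converges_def by blast
  have "((\<lambda>r. \<chi> x. complex_of_real r) \<longlongrightarrow> (\<chi> x::'n. complex_of_real 0)) (at_right 0)"
    by (intro tendsto_intros)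
  moreover have "(\<chi> x::'n. complex_of_real 0) \<in> V" using V(2) by (simp add: zero_vec_def)
  ultimately have "\<forall>\<^sub>F r in at_right 0. (\<chi> x::'n. complex_of_real r) \<in> V"
    using V(1) topological_tendstoD by blast
  then have "\<forall>\<^sub>F r in at_right 0. (\<chi> x::'n. complex_of_real r) \<in> V \<and> r > 0"
    using eventually_at_right_less eventually_conj by blast
  then obtain r where r: "(\<chi> x::'n. complex_of_real r) \<in> V" "r > 0"
    using eventually_happens trivial_limit_at_right_real by blast
  let ?z = "\<chi> x::'n. complex_of_real r"
  let ?f = "\<lambda>x k. norm (mcoeff (h $ x) k * zmonom ?z k)"
  define B where "B = (\<Sum>x\<in>UNIV. infsum (?f x) UNIV)"
  have nonneg: "infsum (?f x) UNIV \<ge> 0" for x by (intro infsum_nonneg) auto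
  then have "B \<ge> 0" unfolding B_def by (intro sum_nonneg) auto
  have B: "?f x k \<le> B" for x k
  proof -
    have "?f x summable_on UNIV"
      by (rule summable_on_iff_abs_summable_on_complex[THEN iffD1, OF V(3)[OF r(1)]])
    then have "sum (?f x) {k} \<le> infsum (?f x) UNIV" by (intro finite_sum_le_infsum) auto
    also have "\<dots> \<le> B" unfolding B_def by (rule member_le_sum) (use nonneg in auto)
    finally show ?thesis by simp
  qed
  \<comment> \<open>One factor \<open>K\<close> dominates \<open>B\<close> and the others dominate 1
    / r, matching the exponent \<open>Suc (mdeg k)\<close>.\<close>
  define K where "K = max B (1 / r)"
  show ?thesis
  proof (rule geo_boundedI[of _ K])
    fix i :: "'n \<times> ('n \<Rightarrow> nat)"
    obtain x k where i: "i = (x, k)" by force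
    have "norm (mcoeff (h $ x) k) * r ^ mdeg k \<le> B"
      using B[of x k] r(2) by (simp add: norm_mult norm_zmonom mdeg_def power_sum)
    then have "norm (mcoeff (h $ x) k) \<le> B * (1 / r) ^ mdeg k"
      using r(2) by (simp add: power_divide field_simps)
    also have "\<dots> \<le> K * K ^ mdeg k"
      using \<open>B \<ge> 0\<close> r(2) by (intro mult_mono power_mono) (auto simp: K_def)
    finally show "norm (case i of (x, k) \<Rightarrow> mcoeff (h $ x) k) \<le> K ^ Suc (case i of (x, k) \<Rightarrow> mdeg k)"
      by (simp add: i)
  qed (use \<open>B \<ge> 0\<close> in \<open>simp add: K_def\<close>)
qed

text \<open>On a small polydisc the terms are dominated by a product of geometric series of ratio
  1/2, one for each variable.\<close>

lemma mfps_converges_if_geo_bounded: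
  fixes h :: "'n::finite mfps ^ 'n"
  assumes "geo_bounded (\<lambda>(x, k). mdeg k) (\<lambda>(x, k). mcoeff (h $ x) k)"
  shows "mfps_converges h"
proof -
  obtain N :: nat where N: "\<And>x k. norm (mcoeff (h $ x) k) \<le> real N * real N ^ mdeg k"
    using assms unfolding geo_bounded_def by auto
  have geo: "Infinite_Set_Sum.abs_summable_on (\<lambda>k::nat. (1 / 2 :: real) ^ k) UNIV"
    by (simp add: abs_summable_on_nat_iff')
  have "Infinite_Set_Sum.abs_summable_on (\<lambda>k. \<Prod>x\<in>(UNIV :: 'n set). (1 / 2 :: real) ^ k x) (PiE UNIV (\<lambda>_. UNIV))"
    by (intro abs_summable_on_prod_PiE geo) auto
  then have "(\<lambda>k. \<Prod>x\<in>(UNIV :: 'n set). (1 / 2 :: real) ^ k x) summable_on UNIV"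
    by (simp add: abs_summable_equivalent[symmetric] prod_nonneg)
  then have dom: "(\<lambda>k. real N * (\<Prod>x\<in>(UNIV :: 'n set). (1 / 2 :: real) ^ k x)) summable_on UNIV"
    by (rule summable_on_cmult_right)
  show ?thesis
    unfolding mfps_converges_def
  \<comment> \<open>The radius forces N |z_y| \<le> 1/2 in every coordinate; N + 1 avoids dividing
    by 0 when N = 0.\<close>
  proof (intro exI[of _ "ball 0 (1 / (2 * (real N + 1)))"] conjI ballI allI)
    fix z :: "complex ^ 'n" and x
    assume "z \<in> ball 0 (1 / (2 * (real N + 1)))"
    then have "norm z < 1 / (2 * (real N + 1))" by simp
    then have "norm (z $ y) \<le> 1 / (2 * (real N + 1))" for y
      using Finite_Cartesian_Product.norm_nth_le[of z y] by linarith
    then have "(real N + 1) * norm (z $ y) \<le> 1 / 2" for y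
      by (simp add: field_simps)
    then have half: "real N * norm (z $ y) \<le> 1 / 2" for y
      by (rule order_trans[rotated]) (auto intro: mult_right_mono)
    have "norm (mcoeff (h $ x) k * zmonom z k) \<le> real N * (\<Prod>y\<in>UNIV. (1 / 2) ^ k y)" for k
    proof -
      have "norm (mcoeff (h $ x) k * zmonom z k) \<le> real N * real N ^ mdeg k * (\<Prod>y\<in>UNIV. norm (z $ y) ^ k y)"
        unfolding norm_mult norm_zmonom by (intro mult_right_mono N prod_nonneg) auto
      also have "\<dots> = real N * (\<Prod>y\<in>UNIV. (real N * norm (z $ y)) ^ k y)"
        by (simp add: mdeg_def power_sum power_mult_distrib prod.distrib)
      also have "\<dots> \<le> real N * (\<Prod>y\<in>UNIV. (1 / 2) ^ k y)"
        by (intro mult_left_mono prod_mono conjI power_mono half) auto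
      finally show ?thesis .
    qed
    then have "(\<lambda>k. norm (mcoeff (h $ x) k * zmonom z k)) summable_on UNIV"
      by (intro summable_on_comparison_test[OF dom]) auto
    then show "(\<lambda>k. mcoeff (h $ x) k * zmonom z k) summable_on UNIV"
      by (rule abs_summable_summable)
  qed auto
qed

section \<open>The dichotomy\<close>

theorem theorem2:
  fixes m d :: nat
    and f :: "(nat \<Rightarrow> nat) \<Rightarrow> complex^'n \<Rightarrow> complex^'n::finite"
    and A :: "complex^'n^'n"
    and h :: "(nat \<Rightarrow> complex) \<Rightarrow> 'n mfps ^ 'n"
    and C0 C1 :: real
  assumes "m \<ge> 1"
    and "\<And>i. i \<in> mindex m \<Longrightarrow> (\<Sum>j<m. i j) \<le> d \<Longrightarrow> holomorphic_germ (f i)"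
    and "\<And>i. i \<in> mindex m \<Longrightarrow> (\<Sum>j<m. i j) \<le> d \<Longrightarrow>
           (\<lambda>z. norm (f i z)) \<in> O[at 0](\<lambda>z. norm z ^ 2)"
    and "invertible A"
    and "\<And>t. t \<in> cspace m \<Longrightarrow> formal_linearization A (param_family m d A f t) (h t)"
    and "C0 > 0" and "C1 > 0"
    and "\<And>x k. poly_of_degree_le m (C0 + C1 * real (mdeg k)) (\<lambda>t. mcoeff (h t $ x) k)"
  shows "(\<forall>t\<in>cspace m. mfps_converges (h t)) \<or>
         (\<exists>E. E \<subseteq> cspace m \<and> gamma_cap m E = 0 \<and>
              (\<forall>t\<in>cspace m - E. \<not> mfps_converges (h t)))"
proof -
  let ?wt = "\<lambda>(x :: 'n, k :: 'n \<Rightarrow> nat). mdeg k"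
  let ?p = "\<lambda>(x, k) t. mcoeff (h t $ x) k"
  have conv: "mfps_converges (h t) \<longleftrightarrow> geo_bounded ?wt (\<lambda>i. ?p i t)" for t
    using geo_bounded_if_mfps_converges[of "h t"] mfps_converges_if_geo_bounded[of "h t"]
    by (auto simp: case_prod_unfold)
  \<comment> \<open>This is the full set of parameters of convergence: either its capacity vanishes
    and it serves as the exceptional set, or it is all of \<open>cspace m\<close>.\<close>
  let ?E = "{t \<in> cspace m. geo_bounded ?wt (\<lambda>i. ?p i t)}"
  \<comment> \<open>With l the valuation, C0 + C1 l \<le> (C0 + C1)(l + 1), which gives the form
    \<open>c * Suc (wt i)\<close>.\<close>
  define c where "c = nat \<lceil>C0 + C1\<rceil>"
  have deg: "line_degree_le m (c * Suc (?wt i)) (?p i)" for i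
  proof -
    obtain x k where i: "i = (x, k)" by force
    have "C0 + C1 * real (mdeg k) \<le> (C0 + C1) * real (Suc (mdeg k))"
      using assms(6,7) by (simp add: algebra_simps)
    also have "\<dots> \<le> real c * real (Suc (mdeg k))"
      unfolding c_def by (intro mult_right_mono real_nat_ceiling_ge) auto
    finally have "C0 + C1 * real (mdeg k) \<le> real (c * Suc (mdeg k))"
      by (simp add: algebra_simps)
    then have "nat \<lfloor>C0 + C1 * real (mdeg k)\<rfloor> \<le> c * Suc (mdeg k)"
      by linarith
    then show ?thesis
      using line_degree_le_mono[OF line_degree_le_poly_of_degree_le[OF assms(8)[of k x]]]
      by (simp add: i)
  qed
  show ?thesis
  proof (cases "gamma_cap m ?E = 0")
    case True
    then show ?thesis by (intro disjI2 exI[of _ ?E]) (auto simp: conv)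
  next
    case False
    then have "gamma_cap m ?E > 0" by (simp add: zero_less_iff_neq_zero)
    then show ?thesis
      using geo_bounded_gamma_cap[where p = ?p, OF assms(1) deg] conv by blast
  qed
qed

end
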